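(* There is no semi-equivelar map with at most $11$ vertices on the double torus (the closed orientable surface of Euler characteristic $-2$).
   Context: A surface is a compact connected 2-dimensional manifold without boundary. A map on a surface $S$ is a finite (combinatorial) polyhedral 2-complex $X$ whose geometric carrier is $S$: a finite vertex set $V(X)$, edges, and 2-faces that are polygons ($n$-gons, $n\ge 3$, each identified with a cycle $C_n$ of $n$ distinct vertices), such that any two distinct faces meet in the empty set, a single common vertex, or a single common edge. The faces containing a vertex $v$ are arranged cyclically around $v$. The vertex $v$ has face sequence $(a_1^{n_1},a_2^{n_2},\dots,a_m^{n_m})$ (with $a_i\ge 3$, $n_i\ge 1$) if, going around $v$, one meets $n_1$ consecutive $a_1$-gons, then $n_2$ consecutive $a_2$-gons, ..., then $n_m$ consecutive $a_m$-gons; the sequence is considered up to cyclic rotation and reversal. A map is semi-equivelar (a SEM) if all its vertices have the same face sequence. *)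

theory Defs
  imports "HOL-Analysis.Analysis"
begin

section \<open>Polygonal complexes\<close>

text \<open>A complex is given by its set of 2-faces, and a 2-face is a cycle graph, represented by
  its set of edges, each edge being the set of its two end vertices.  A cycle is determined by
  its edge set, so this avoids choosing a starting point or a direction.  Isolated vertices and
  edges outside every face are not represented: the carrier of a map is a surface, so every
  vertex and every edge of a map lies in a face.\<close>

definition cycle_arcs :: "'a list \<Rightarrow> ('a \<times> 'a) set" where
  "cycle_arcs p = {(p ! i, p ! (Suc i mod length p)) | i. i < length p}"

definition cycle_edges :: "'a list \<Rightarrow> 'a set set" where
  "cycle_edges p = (\<lambda>(u, w). {u, w}) ` cycle_arcs p"

definition traverses :: "'a list \<Rightarrow> 'a set set \<Rightarrow> bool" where
  "traverses p f \<longleftrightarrow> distinct p \<and> 3 \<le> length p \<and> cycle_edges p = f"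

definition polygon :: "'a set set \<Rightarrow> bool" where
  "polygon f \<longleftrightarrow> (\<exists>p. traverses p f)"

definition edges :: "'a set set set \<Rightarrow> 'a set set" where
  "edges X = \<Union>X"

definition verts :: "'a set set set \<Rightarrow> 'a set" where
  "verts X = \<Union>(edges X)"

definition polyhedral_complex :: "'a set set set \<Rightarrow> bool" where
  "polyhedral_complex X \<longleftrightarrow>
     finite X \<and> (\<forall>f\<in>X. polygon f) \<and>
     (\<forall>f\<in>X. \<forall>g\<in>X. f \<noteq> g \<longrightarrow>
        \<Union>f \<inter> \<Union>g = {} \<or> (\<exists>v. \<Union>f \<inter> \<Union>g = {v}) \<or> \<Union>f \<inter> \<Union>g \<in> f \<inter> g)"

definition euler_char :: "'a set set set \<Rightarrow> int" where
  "euler_char X = int (card (verts X)) - int (card (edges X)) + int (card X)"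

text \<open>Coherent orientation: the faces can be directed so that no two of them traverse a common
  edge in the same direction.\<close>

definition orientable :: "'a set set set \<Rightarrow> bool" where
  "orientable X \<longleftrightarrow>
     (\<exists>p. (\<forall>f\<in>X. traverses (p f) f) \<and>
          (\<forall>f\<in>X. \<forall>g\<in>X. f \<noteq> g \<longrightarrow> cycle_arcs (p f) \<inter> cycle_arcs (p g) = {}))"


section \<open>Geometric carrier and surfaces\<close>

text \<open>Each polygon \<open>f\<close> is realised as the cone over its boundary cycle, with apex \<open>Inr f\<close>, and
  hence as a union of triangles, one for each edge of \<open>f\<close>.  A point is the function giving its
  barycentric coordinates with respect to the vertices \<open>Inl v\<close> and the apexes \<open>Inr f\<close>; points
  on a common edge or vertex of two polygons have the same coordinates and are thereby
  identified.\<close>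

definition cone_triangle :: "'a set set \<Rightarrow> 'a set \<Rightarrow> ('a + 'a set set \<Rightarrow> real) set" where
  "cone_triangle f e =
     {x. (\<forall>c. 0 \<le> x c) \<and> (\<forall>c. c \<notin> insert (Inr f) (Inl ` e) \<longrightarrow> x c = 0) \<and>
         (\<Sum>c\<in>insert (Inr f) (Inl ` e). x c) = 1}"

definition carrier_set :: "'a set set set \<Rightarrow> ('a + 'a set set \<Rightarrow> real) set" where
  "carrier_set X = (\<Union>f\<in>X. \<Union>e\<in>f. cone_triangle f e)"

definition geometric_carrier :: "'a set set set \<Rightarrow> ('a + 'a set set \<Rightarrow> real) topology" where
  "geometric_carrier X = subtopology (powertop_real UNIV) (carrier_set X)"

text \<open>Second countability is not listed, since it follows from compactness and the existence of
  charts.\<close>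

definition surface :: "'b topology \<Rightarrow> bool" where
  "surface T \<longleftrightarrow>
     topspace T \<noteq> {} \<and> compact_space T \<and> connected_space T \<and> Hausdorff_space T \<and>
     (\<forall>x\<in>topspace T. \<exists>U (W :: (real^2) set). openin T U \<and> x \<in> U \<and> open W \<and>
        subtopology T U homeomorphic_space top_of_set W)"

definition surface_map :: "'a set set set \<Rightarrow> bool" where
  "surface_map X \<longleftrightarrow> polyhedral_complex X \<and> surface (geometric_carrier X)"

text \<open>The double torus is the closed orientable surface of Euler characteristic \<open>-2\<close>.\<close>

definition double_torus_map :: "'a set set set \<Rightarrow> bool" where
  "double_torus_map X \<longleftrightarrow> surface_map X \<and> orientable X \<and> euler_char X = -2"


section \<open>Face sequences\<close>

text \<open>The edges \<open>es\<close> and faces \<open>fs\<close> at \<open>v\<close> in cyclic order: the face \<open>fs ! i\<close> lies between the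
  edges \<open>es ! i\<close> and \<open>es ! (i + 1)\<close>, indices being taken cyclically.  Recording the edges as well
  as the faces ensures that successive faces are adjacent across successive, pairwise different
  edges at \<open>v\<close>.\<close>

definition cyclic_order_at ::
    "'a set set set \<Rightarrow> 'a \<Rightarrow> 'a set list \<Rightarrow> 'a set set list \<Rightarrow> bool" where
  "cyclic_order_at X v es fs \<longleftrightarrow>
     length es = length fs \<and> distinct es \<and> distinct fs \<and>
     set es = {e \<in> edges X. v \<in> e} \<and> set fs = {f \<in> X. v \<in> \<Union>f} \<and>
     (\<forall>i<length fs. es ! i \<in> fs ! i \<and> es ! (Suc i mod length fs) \<in> fs ! i)"

text \<open>The list \<open>[(a\<^sub>1, n\<^sub>1), \<dots>, (a\<^sub>m, n\<^sub>m)]\<close> stands for the face sequence with \<open>n\<^sub>1\<close> consecutive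
  \<open>a\<^sub>1\<close>-gons, then \<open>n\<^sub>2\<close> consecutive \<open>a\<^sub>2\<close>-gons, and so on.  An \<open>a\<close>-gon has \<open>a\<close> edges, so \<open>card f\<close> is
  its size.  As the cyclic order at \<open>v\<close> may start at any face and run in either direction, a
  vertex has, along with a face sequence, all its rotations and its reversal.\<close>

definition has_face_sequence :: "'a set set set \<Rightarrow> 'a \<Rightarrow> (nat \<times> nat) list \<Rightarrow> bool" where
  "has_face_sequence X v s \<longleftrightarrow>
     (\<forall>(a, n)\<in>set s. 3 \<le> a \<and> 1 \<le> n) \<and>
     (\<exists>es fs. cyclic_order_at X v es fs \<and>
        map card fs = concat (map (\<lambda>(a, n). replicate n a) s))"

definition semi_equivelar :: "'a set set set \<Rightarrow> bool" where
  "semi_equivelar X \<longleftrightarrow> (\<exists>s. \<forall>v\<in>verts X. has_face_sequence X v s)"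

end

theory Submission
  imports Defs
begin

text \<open>Let \<open>n\<close> be the number of vertices and \<open>L\<close> the list of the sizes of the faces around a vertex,
  the same for every vertex.  Counting edges and faces through the vertices they contain turns the
  Euler characteristic into \<open>n * (1 - length L / 2 + (\<Sum>a\<leftarrow>L. 1 / a)) = -2\<close>.  On the other hand, as
  two faces share at most an edge, the faces around a vertex have \<open>1 + S\<close> vertices in all, where
  \<open>S = (\<Sum>a\<leftarrow>L. a - 2)\<close>, so that \<open>S + 1 \<le> n\<close> (lemma \<open>star_size\<close>).

  These two conditions already conflict for \<open>n \<le> 11\<close> (lemma \<open>no_small_vertex_type\<close>).  Triangles
  produce negative curvature with the fewest vertices, and \<open>d a = (a - 2) * (a - 3) / a\<close> measures
  what an \<open>a\<close>-gon loses against \<open>a - 2\<close> triangles.  The Euler equation says that the total loss is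
  \<open>D = S - 6 - 12 / n\<close>, and hence \<open>D \<le> n - 7 - 12 / n\<close>.  This is negative for \<open>n \<le> 8\<close>.  For
  \<open>n \<le> 11\<close> it is less than \<open>3\<close>, so that no face has more than seven sides; then \<open>70 * D\<close> is an
  integer, and so is \<open>840 / n\<close>, which excludes \<open>9\<close> and \<open>11\<close>.  For \<open>n = 10\<close>, finally, only triangles,
  quadrangles and pentagons are possible, with losses \<open>0\<close>, \<open>1 / 2\<close> and \<open>6 / 5\<close>, but
  \<open>D = S - 36 / 5\<close> is \<open>4 / 5\<close> or \<open>9 / 5\<close>, and neither is a sum of such losses.\<close>


section \<open>Polygons\<close>

lemma cycle_edges_image:
  "cycle_edges p = (\<lambda>i. {p ! i, p ! (Suc i mod length p)}) ` {..<length p}"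
  unfolding cycle_edges_def cycle_arcs_def by auto

lemma Suc_mod_cases:
  assumes "i < n"
  shows "Suc i mod n = (if Suc i = n then 0 else Suc i)"
  using assms by auto

lemma traverses_Union:
  assumes "traverses p f"
  shows "\<Union>f = set p"
proof -
  have f: "f = (\<lambda>i. {p ! i, p ! (Suc i mod length p)}) ` {..<length p}"
    using assms by (simp add: traverses_def cycle_edges_image)
  have "Suc i mod length p < length p" if "i < length p" for i
    using that by (intro mod_less_divisor) auto
  then have "p ! (Suc i mod length p) \<in> set p" if "i < length p" for i
    using that by (intro nth_mem)
  then show ?thesis
    unfolding f by (auto simp: in_set_conv_nth[of _ p] intro: nth_mem)
qed

lemma traverses_card:
  assumes "traverses p f"
  shows "card f = length p"
proof -
  let ?n = "length p"
  have p: "distinct p" "3 \<le> ?n"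
    and f: "f = (\<lambda>i. {p ! i, p ! (Suc i mod ?n)}) ` {..<?n}"
    using assms by (auto simp: traverses_def cycle_edges_image)
  have "inj_on (\<lambda>i. {p ! i, p ! (Suc i mod ?n)}) {..<?n}"
  proof (rule inj_onI)
    fix i j assume ij: "i \<in> {..<?n}" "j \<in> {..<?n}"
      and eq: "{p ! i, p ! (Suc i mod ?n)} = {p ! j, p ! (Suc j mod ?n)}"
    have m: "Suc i mod ?n < ?n" "Suc j mod ?n < ?n"
      using p(2) by (auto intro!: mod_less_divisor)
    have "i = j \<or> i = Suc j mod ?n \<and> Suc i mod ?n = j"
      using eq ij m p(1) by (auto simp: doubleton_eq_iff nth_eq_iff_index_eq)
    \<comment> \<open>In the second case \<open>i\<close> would be its own second successor, which needs length at most two.\<close>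
    then show "i = j"
      using ij p(2) by (auto simp: Suc_mod_cases split: if_splits)
  qed
  then show ?thesis
    unfolding f by (simp add: card_image)
qed

lemma traverses_edge_card:
  assumes "traverses p f" "e \<in> f"
  shows "card e = 2"
proof -
  obtain i where i: "i < length p" "e = {p ! i, p ! (Suc i mod length p)}"
    using assms by (auto simp: traverses_def cycle_edges_image)
  have "Suc i mod length p < length p" "i \<noteq> Suc i mod length p"
    using i(1) assms(1) by (auto simp: Suc_mod_cases traverses_def)
  then have "p ! i \<noteq> p ! (Suc i mod length p)"
    using i(1) assms(1) by (simp add: traverses_def nth_eq_iff_index_eq)
  then show ?thesis
    using i(2) by simp
qed

lemma traverses_degree_le_2:
  assumes "traverses p f"
  shows "card {e \<in> f. v \<in> e} \<le> 2"
proof (cases "v \<in> set p")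
  case True
  let ?n = "length p"
  let ?E = "\<lambda>i. {p ! i, p ! (Suc i mod ?n)}"
  obtain k where k: "k < ?n" "v = p ! k"
    using True by (auto simp: in_set_conv_nth)
  have p: "distinct p" and f: "f = ?E ` {..<?n}"
    using assms by (auto simp: traverses_def cycle_edges_image)
  \<comment> \<open>the cyclic predecessor of \<open>k\<close>\<close>
  define k' where "k' = (if k = 0 then ?n - 1 else k - 1)"
  have "{e \<in> f. v \<in> e} \<subseteq> ?E ` {k, k'}"
  proof
    fix e assume "e \<in> {e \<in> f. v \<in> e}"
    then obtain i where i: "i < ?n" "e = ?E i" "v \<in> ?E i"
      by (auto simp: f)
    have "Suc i mod ?n < ?n"
      using i(1) by (intro mod_less_divisor) auto
    then have "k = i \<or> k = Suc i mod ?n"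
      using i k p by (auto simp: nth_eq_iff_index_eq)
    then have "i \<in> {k, k'}"
      using i(1) by (auto simp: Suc_mod_cases k'_def split: if_splits)
    then show "e \<in> ?E ` {k, k'}"
      using i(2) by blast
  qed
  then have "card {e \<in> f. v \<in> e} \<le> card (?E ` {k, k'})"
    by (intro card_mono) auto
  also have "\<dots> \<le> card {k, k'}"
    by (rule card_image_le) simp
  also have "\<dots> \<le> 2"
    by (simp add: card_insert_if)
  finally show ?thesis .
next
  case False
  then have "{e \<in> f. v \<in> e} = {}"
    using traverses_Union[OF assms] by auto
  then show ?thesis
    by (simp only: card.empty)
qed

lemma polygon_facts:
  assumes "polygon f"
  shows "finite f" "3 \<le> card f" "finite (\<Union>f)" "card (\<Union>f) = card f"
    "\<And>e. e \<in> f \<Longrightarrow> card e = 2" "\<And>v. card {e \<in> f. v \<in> e} \<le> 2"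
proof -
  obtain p where p: "traverses p f"
    using assms by (auto simp: polygon_def)
  then have len: "distinct p" "3 \<le> length p"
    by (auto simp: traverses_def)
  show "3 \<le> card f" "card (\<Union>f) = card f" "finite (\<Union>f)"
    using len by (simp_all add: traverses_card[OF p] traverses_Union[OF p] distinct_card)
  then show "finite f"
    by (intro card_ge_0_finite) linarith
  show "card e = 2" if "e \<in> f" for e
    using traverses_edge_card[OF p that] .
  show "card {e \<in> f. v \<in> e} \<le> 2" for v
    using traverses_degree_le_2[OF p] .
qed


section \<open>Counting in a polyhedral complex\<close>

lemma polyhedral_complex_facts:
  assumes "polyhedral_complex X"
  shows "finite X" "finite (edges X)" "finite (verts X)" "\<And>f. f \<in> X \<Longrightarrow> polygon f"
    "\<And>e. e \<in> edges X \<Longrightarrow> card e = 2" "\<And>e. e \<in> edges X \<Longrightarrow> e \<subseteq> verts X"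
    "\<And>f. f \<in> X \<Longrightarrow> \<Union>f \<subseteq> verts X"
proof -
  show X: "finite X" and pol: "\<And>f. f \<in> X \<Longrightarrow> polygon f"
    using assms by (auto simp: polyhedral_complex_def)
  show c: "\<And>e. e \<in> edges X \<Longrightarrow> card e = 2"
    using pol polygon_facts(5) by (auto simp: edges_def)
  show E: "finite (edges X)"
    unfolding edges_def using X pol polygon_facts(1) by blast
  show "finite (verts X)"
    unfolding verts_def using E c by (metis card.infinite finite_Union zero_neq_numeral)
  show "\<And>e. e \<in> edges X \<Longrightarrow> e \<subseteq> verts X" "\<And>f. f \<in> X \<Longrightarrow> \<Union>f \<subseteq> verts X"
    by (auto simp: verts_def edges_def)
qed

lemma sum_degrees:
  assumes "polyhedral_complex X"
  shows "(\<Sum>v\<in>verts X. card {e \<in> edges X. v \<in> e}) = 2 * card (edges X)"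
proof -
  note X = polyhedral_complex_facts[OF assms]
  have "(\<Sum>v\<in>verts X. card {e \<in> edges X. v \<in> e}) =
      (\<Sum>v\<in>verts X. \<Sum>e\<in>{e \<in> edges X. v \<in> e}. 1)"
    by simp
  also have "\<dots> = (\<Sum>e\<in>edges X. \<Sum>v\<in>{v \<in> verts X. v \<in> e}. 1)"
    by (rule sum.swap_restrict) (use X in auto)
  also have "\<dots> = (\<Sum>e\<in>edges X. 2)"
  proof (rule sum.cong)
    fix e assume e: "e \<in> edges X"
    then have "{v \<in> verts X. v \<in> e} = e"
      using X(6) by auto
    then show "(\<Sum>v\<in>{v \<in> verts X. v \<in> e}. 1) = (2::nat)"
      using X(5)[OF e] by simp
  qed simp
  finally show ?thesis
    by simp
qed

text \<open>Each face spreads a total weight of one evenly over its vertices.\<close>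

lemma sum_face_shares:
  assumes "polyhedral_complex X"
  shows "(\<Sum>v\<in>verts X. \<Sum>f\<in>{f \<in> X. v \<in> \<Union>f}. 1 / real (card f)) = real (card X)"
proof -
  note X = polyhedral_complex_facts[OF assms]
  have "(\<Sum>v\<in>verts X. \<Sum>f\<in>{f \<in> X. v \<in> \<Union>f}. 1 / real (card f)) =
      (\<Sum>f\<in>X. \<Sum>v\<in>{v \<in> verts X. v \<in> \<Union>f}. 1 / real (card f))"
    by (rule sum.swap_restrict) (use X in auto)
  also have "\<dots> = (\<Sum>f\<in>X. 1)"
  proof (rule sum.cong)
    fix f assume f: "f \<in> X"
    then have "{v \<in> verts X. v \<in> \<Union>f} = \<Union>f"
      using X(7) by blast
    then show "(\<Sum>v\<in>{v \<in> verts X. v \<in> \<Union>f}. 1 / real (card f)) = 1"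
      using polygon_facts(2,4)[OF X(4)[OF f]] by simp
  qed simp
  finally show ?thesis
    by simp
qed

text \<open>Two faces that share \<open>v\<close> and a second vertex \<open>x\<close> must share the edge \<open>{v, x}\<close>.  Hence the
  vertices of a face at \<open>v\<close> that are neither \<open>v\<close> nor one of its two neighbours on that face occur
  in no other face at \<open>v\<close>, and are not adjacent to \<open>v\<close> at all.  The star of \<open>v\<close> therefore consists
  of \<open>v\<close>, one neighbour for each edge at \<open>v\<close>, and at least \<open>card f - 3\<close> private vertices for each
  face \<open>f\<close> at \<open>v\<close>.\<close>

lemma star_size:
  assumes "polyhedral_complex X" "v \<in> verts X"
  shows "card {e \<in> edges X. v \<in> e} + (\<Sum>f\<in>{f \<in> X. v \<in> \<Union>f}. card f - 3) + 1 \<le> card (verts X)"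
proof -
  note X = polyhedral_complex_facts[OF assms(1)]
  define Fv where "Fv = {f \<in> X. v \<in> \<Union>f}"
  define N where "N = {w. {v, w} \<in> edges X}"
  define A where "A f = \<Union>f - {v} - {w. {v, w} \<in> f}" for f
  have pol: "polygon f" if "f \<in> Fv" for f
    using that X(4) by (simp add: Fv_def)
  have edge: "{v, x} \<in> f"
    if "f \<in> Fv" "g \<in> X" "f \<noteq> g" "v \<in> \<Union>g" "x \<in> \<Union>f" "x \<in> \<Union>g" "x \<noteq> v" for f g x
  proof -
    define I where "I = \<Union>f \<inter> \<Union>g"
    have sub: "v \<in> I" "x \<in> I" and "f \<in> X"
      using that by (auto simp: Fv_def I_def)
    have "I = {} \<or> (\<exists>u. I = {u}) \<or> I \<in> f \<inter> g"
      using assms(1) that(2,3) \<open>f \<in> X\<close> unfolding polyhedral_complex_def I_def by blast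
    then have meet: "I \<in> f"
      using sub \<open>x \<noteq> v\<close> by auto
    then have card_I: "card I = 2"
      by (rule polygon_facts(5)[OF pol[OF that(1)]])
    then have "finite I"
      by (intro card_ge_0_finite) simp
    then have "{v, x} = I"
      using sub card_I \<open>x \<noteq> v\<close> by (intro card_subset_eq) simp_all
    with meet show ?thesis
      by simp
  qed
  have nbr: "\<exists>w. e = {v, w}" if "card e = 2" "v \<in> e" for e
    using that by (auto simp: card_2_iff)
  have cardN: "card N = card {e \<in> edges X. v \<in> e}"
  proof (rule bij_betw_same_card)
    show "bij_betw (\<lambda>w. {v, w}) N {e \<in> edges X. v \<in> e}"
      using nbr X(5) by (fastforce simp: bij_betw_def N_def inj_on_def doubleton_eq_iff)
  qed
  have finA: "finite (A f)" and cardA: "card f - 3 \<le> card (A f)" if "f \<in> Fv" for f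
  proof -
    note P = polygon_facts[OF pol[OF that]]
    show "finite (A f)"
      using P(3) by (simp add: A_def)
    have "inj_on (\<lambda>w. {v, w}) {w. {v, w} \<in> f}"
      by (auto simp: inj_on_def doubleton_eq_iff)
    moreover have "(\<lambda>w. {v, w}) ` {w. {v, w} \<in> f} \<subseteq> {e \<in> f. v \<in> e}"
      by auto
    ultimately have fin: "finite {w. {v, w} \<in> f}" and "card {w. {v, w} \<in> f} \<le> card {e \<in> f. v \<in> e}"
      using P(1) by (auto intro: inj_on_finite card_inj_on_le)
    then have "card {w. {v, w} \<in> f} \<le> 2"
      using P(6)[of v] by linarith
    moreover have "card (\<Union>f) - card {v} \<le> card (\<Union>f - {v})"
      by (rule diff_card_le_card_Diff) simp
    moreover have "card (\<Union>f - {v}) - card {w. {v, w} \<in> f} \<le> card (A f)"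
      unfolding A_def by (rule diff_card_le_card_Diff) (rule fin)
    ultimately show "card f - 3 \<le> card (A f)"
      using P(4) by simp
  qed
  have disjA: "A f \<inter> A g = {}" if "f \<in> Fv" "g \<in> Fv" "f \<noteq> g" for f g
    using that edge[of f g] by (auto simp: A_def Fv_def)
  have disjN: "N \<inter> (\<Union>f\<in>Fv. A f) = {}"
  proof (rule ccontr)
    assume "N \<inter> (\<Union>f\<in>Fv. A f) \<noteq> {}"
    then obtain w f where w: "{v, w} \<in> edges X" "f \<in> Fv" "w \<in> A f"
      by (auto simp: N_def)
    then obtain g where g: "g \<in> X" "{v, w} \<in> g"
      by (auto simp: edges_def)
    moreover have "g \<noteq> f"
      using g(2) w(3) by (auto simp: A_def)
    ultimately show False
      using edge[OF w(2), of g w] w(3) by (auto simp: A_def)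
  qed
  have vN: "v \<notin> N"
    using X(5)[of "{v}"] by (auto simp: N_def)
  have N: "N \<subseteq> verts X"
    using X(6) by (auto simp: N_def)
  have A: "(\<Union>f\<in>Fv. A f) \<subseteq> verts X"
    using X(7) by (auto simp: A_def Fv_def)
  have finFv: "finite Fv"
    using X(1) by (simp add: Fv_def)
  have "(\<Sum>f\<in>Fv. card f - 3) \<le> (\<Sum>f\<in>Fv. card (A f))"
    using cardA by (rule sum_mono)
  also have "\<dots> = card (\<Union>f\<in>Fv. A f)"
    using finFv finA disjA by (intro card_UN_disjoint [symmetric]) auto
  finally have "card N + (\<Sum>f\<in>Fv. card f - 3) \<le> card (N \<union> (\<Union>f\<in>Fv. A f))"
    using disjN N A X(3) by (subst card_Un_disjoint) (auto intro: finite_subset)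
  also have "Suc \<dots> = card (insert v (N \<union> (\<Union>f\<in>Fv. A f)))"
    using vN N A X(3)
    by (subst card_insert_disjoint) (auto intro: finite_subset simp: A_def)
  also have "\<dots> \<le> card (verts X)"
    using N A X(3) assms(2) by (intro card_mono) auto
  finally show ?thesis
    using cardN by (simp add: Fv_def)
qed


section \<open>The arithmetic of vertex types\<close>

text \<open>The loss \<open>(a - 2) * (a - 3) / a\<close> of an \<open>a\<close>-gon against \<open>a - 2\<close> triangles, expanded as
  \<open>a - 5 + 6 / a\<close>, increases with \<open>a\<close>, so that a bound on it bounds \<open>a\<close>.\<close>

lemma face_defect_ge:
  fixes a :: nat
  assumes "3 \<le> k" "k \<le> a"
  shows "real k - 5 + 6 / real k \<le> real a - 5 + 6 / real a"
proof -
  have "real k * real a \<ge> 3 * 3"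
    using assms by (intro mult_mono) auto
  then have "0 \<le> (real a - real k) * (real k * real a - 6) / (real k * real a)"
    using assms by (intro divide_nonneg_nonneg mult_nonneg_nonneg) auto
  also have "\<dots> = (real a - 5 + 6 / real a) - (real k - 5 + 6 / real k)"
    using assms by (simp add: field_simps)
  finally show ?thesis
    by simp
qed

text \<open>The total loss \<open>D\<close> is determined by \<open>S\<close> and \<open>n\<close>; it is small because \<open>S < n\<close>, while the small
  values that sums of losses can take are sparse.\<close>

lemma no_small_vertex_type:
  fixes L :: "nat list" and n :: nat
  assumes L: "\<forall>a\<in>set L. 3 \<le> a"
    and star: "(\<Sum>a\<leftarrow>L. a - 2) + 1 \<le> n"
    and euler: "real n * (1 - real (length L) / 2 + (\<Sum>a\<leftarrow>L. 1 / real a)) = -2"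
    and "n \<le> 11"
  shows False
proof -
  define S where "S = (\<Sum>a\<leftarrow>L. a - 2)"
  define d where "d a = real a - 5 + 6 / real a" for a
  define D where "D = (\<Sum>a\<leftarrow>L. d a)"
  have n0: "n > 0"
    using star by linarith
  have d_nonneg: "0 \<le> d a" if "a \<in> set L" for a
    using L that face_defect_ge[of 3 a] by (simp add: d_def)
  have "real S = (\<Sum>a\<leftarrow>L. real a) - 2 * real (length L)"
    using L unfolding S_def by (induction L) (auto simp: algebra_simps)
  moreover have "D = (\<Sum>a\<leftarrow>L. real a) - 5 * real (length L) + 6 * (\<Sum>a\<leftarrow>L. 1 / real a)"
    unfolding D_def d_def by (induction L) (auto simp: algebra_simps)
  moreover have "1 - real (length L) / 2 + (\<Sum>a\<leftarrow>L. 1 / real a) = -2 / real n"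
    using euler n0 by (simp add: field_simps)
  ultimately have D_eq: "D = real S - 6 - 12 / real n"
    by argo
  have S_le: "S + 1 \<le> n"
    using star by (simp add: S_def)
  have d_le: "d a \<le> D" if "a \<in> set L" for a
    unfolding D_def using that d_nonneg by (intro member_le_sum_list) auto
  have D_nonneg: "0 \<le> D"
    unfolding D_def using d_nonneg by (intro sum_list_nonneg) auto
  have "n > 8"
  proof (rule ccontr)
    assume "\<not> n > 8"
    then have "12 / 8 \<le> 12 / real n"
      using n0 by (intro divide_left_mono) auto
    then show False
      using D_eq D_nonneg S_le \<open>\<not> n > 8\<close> by simp
  qed
  have "n dvd 840"
  proof -
    have "1 < 12 / real n" "real S \<le> 10"
      using n0 S_le \<open>n \<le> 11\<close> by (auto simp: less_divide_eq)
    then have "D < 3"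
      using D_eq by linarith
    \<comment> \<open>70 is a common denominator of the losses of triangles up to heptagons: 0, 1/2, 6/5, 2, 20/7.\<close>
    have int_d: "70 * d a \<in> \<int>" if "a \<in> set L" for a
    proof -
      \<comment> \<open>An octagon already loses 15/4.\<close>
      have "\<not> 8 \<le> a"
        using face_defect_ge[of 8 a] d_le[OF that] \<open>D < 3\<close> by (auto simp: d_def)
      then have "a \<in> {3, 4, 5, 6, 7}"
        using L that by force
      then show ?thesis
        by (auto simp: d_def)
    qed
    have "70 * (\<Sum>a\<leftarrow>K. d a) \<in> \<int>" if "set K \<subseteq> set L" for K
      using that int_d by (induction K) (auto simp: distrib_left)
    then have "70 * D \<in> \<int>"
      unfolding D_def by blast
    moreover have "70 * (real S - 6) \<in> \<int>"
      by (intro Ints_mult Ints_diff) auto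
    ultimately have "70 * (real S - 6) - 70 * D \<in> \<int>"
      by (intro Ints_diff)
    then have "840 / real n \<in> \<int>"
      using D_eq by (simp add: algebra_simps)
    then obtain z where "840 / real n = of_int z"
      by (elim Ints_cases)
    then have "real_of_int 840 = real_of_int (int n * z)"
      using n0 by (simp add: field_simps)
    then have "int n dvd 840"
      by (metis dvd_triv_left of_int_eq_iff)
    then show ?thesis
      by presburger
  qed
  have n: "n = 10"
  proof -
    have "n = 9 \<or> n = 10 \<or> n = 11"
      using \<open>n > 8\<close> \<open>n \<le> 11\<close> by linarith
    then show ?thesis
      using \<open>n dvd 840\<close> by auto
  qed
  have a: "a \<in> {3, 4, 5}" if "a \<in> set L" for a
  proof -
    \<comment> \<open>A hexagon loses 2, but here \<open>D \<le> 9 - 36 / 5\<close>.\<close>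
    have "\<not> 6 \<le> a"
      using face_defect_ge[of 6 a] d_le[OF that] D_eq S_le n by (auto simp: d_def)
    then show ?thesis
      using L that by force
  qed
  have "\<exists>x y :: nat. 10 * (\<Sum>a\<leftarrow>K. d a) = 5 * real x + 12 * real y"
    if "set K \<subseteq> {3, 4, 5}" for K
    using that
  proof (induction K)
    case Nil
    show ?case by (intro exI[of _ 0]) simp
  next
    case (Cons a K)
    then obtain x y :: nat where xy: "10 * (\<Sum>a\<leftarrow>K. d a) = 5 * real x + 12 * real y"
      by auto
    have "a = 3 \<or> a = 4 \<or> a = 5"
      using Cons.prems by auto
    then show ?case
    proof (elim disjE)
      assume "a = 3" then show ?thesis
        using xy by (intro exI[of _ x] exI[of _ y]) (simp add: d_def)
    next
      assume "a = 4" then show ?thesis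
        using xy by (intro exI[of _ "Suc x"] exI[of _ y]) (simp add: d_def)
    next
      assume "a = 5" then show ?thesis
        using xy by (intro exI[of _ x] exI[of _ "Suc y"]) (simp add: d_def)
    qed
  qed
  then obtain x y :: nat where "10 * D = 5 * real x + 12 * real y"
    using a unfolding D_def by blast
  then have "real (5 * x + 12 * y + 72) = real (10 * S)"
    using D_eq n by simp
  then have "5 * x + 12 * y + 72 = 10 * S"
    by (simp only: of_nat_eq_iff)
  \<comment> \<open>As \<open>S \<le> 9\<close>, the value \<open>5 * x + 12 * y\<close> would have to be 8 or 18.\<close>
  with S_le n show False
    by presburger
qed


section \<open>The double torus\<close>

theorem proposition1p1:
  shows "\<not> (\<exists>X :: 'a set set set.
           double_torus_map X \<and> semi_equivelar X \<and> card (verts X) \<le> 11)"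
proof
  assume "\<exists>X :: 'a set set set. double_torus_map X \<and> semi_equivelar X \<and> card (verts X) \<le> 11"
  then obtain X :: "'a set set set" and s where
    X: "polyhedral_complex X" and chi: "euler_char X = -2" and n: "card (verts X) \<le> 11"
    and s: "\<forall>v\<in>verts X. has_face_sequence X v s"
    by (auto simp: double_torus_map_def surface_map_def semi_equivelar_def)
  define L where "L = concat (map (\<lambda>(a, n). replicate n a) s)"
  have deg: "card {e \<in> edges X. v \<in> e} = length L" (is ?deg)
    and sums: "(\<Sum>f\<in>{f \<in> X. v \<in> \<Union>f}. h (card f)) = (\<Sum>a\<leftarrow>L. h a)" (is ?sums)
    if v: "v \<in> verts X" for v and h :: "nat \<Rightarrow> 'b::comm_monoid_add"
  proof -
    obtain es fs where o: "cyclic_order_at X v es fs" "map card fs = L"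
      using s v by (auto simp: has_face_sequence_def L_def)
    have "length es = length L"
      using o by (auto simp: cyclic_order_at_def)
    then show ?deg
      using o(1) by (metis cyclic_order_at_def distinct_card)
    have "(\<Sum>f\<in>set fs. h (card f)) = (\<Sum>f\<leftarrow>fs. h (card f))"
      using o(1) by (simp add: cyclic_order_at_def sum_list_distinct_conv_sum_set)
    then show ?sums
      using o by (auto simp: cyclic_order_at_def o_def)
  qed
  \<comment> \<open>The empty complex has Euler characteristic 0.\<close>
  have verts: "verts X \<noteq> {}"
  proof
    assume "verts X = {}"
    have "real (card X) = 0"
      using sum_face_shares[OF X] \<open>verts X = {}\<close> by simp
    moreover have "card (edges X) = 0"
      using sum_degrees[OF X] \<open>verts X = {}\<close> by simp
    ultimately show False
      using chi \<open>verts X = {}\<close> by (simp add: euler_char_def)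
  qed
  then obtain v where v: "v \<in> verts X"
    by blast
  have L: "\<forall>a\<in>set L. 3 \<le> a"
    using s v unfolding has_face_sequence_def L_def by auto
  show False
  proof (rule no_small_vertex_type[OF L _ _ n])
    have "(\<Sum>a\<leftarrow>L. a - 2) = length L + (\<Sum>a\<leftarrow>L. a - 3)"
      using L by (induction L) auto
    \<comment> \<open>\<open>a - 2\<close> counts the private vertices of a face and one of the neighbours of \<open>v\<close>.\<close>
    then show "(\<Sum>a\<leftarrow>L. a - 2) + 1 \<le> card (verts X)"
      using star_size[OF X v] deg[OF v] sums[OF v, of "\<lambda>a. a - 3"] by simp
  next
    have "card (verts X) * length L = 2 * card (edges X)"
      using sum_degrees[OF X] deg by simp
    then have "real (card (verts X)) * real (length L) = 2 * real (card (edges X))"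
      by (metis of_nat_mult of_nat_numeral)
    moreover have "real (card (verts X)) * (\<Sum>a\<leftarrow>L. 1 / real a) = real (card X)"
      using sum_face_shares[OF X] sums[of _ "\<lambda>a. 1 / real a"] by simp
    moreover have "real (card (verts X)) - real (card (edges X)) + real (card X) = -2"
      using chi unfolding euler_char_def by linarith
    ultimately show "real (card (verts X)) *
        (1 - real (length L) / 2 + (\<Sum>a\<leftarrow>L. 1 / real a)) = -2"
      by (simp add: algebra_simps)
  qed
qed

end
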